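(* Let $M\ge1$ and $N\ge M+2$ be integers and let $\Lambda=\Lambda^{\rm a}\cup\Lambda^{\rm c}\subset\mathbb{Z}$ with $\Lambda^{\rm a}=\{-M,\dots,M\}$ and $\Lambda^{\rm c}=\{-N,\dots,-M-1\}\cup\{M+1,\dots,N\}$. Let the coupled atomistic/continuum operator be $$\mathcal{L}_{\rm cpl}[u](\xi)=\begin{cases}-k_2\big(u(\xi-2)-2u(\xi)+u(\xi+2)\big)-k_1\big(u(\xi-1)-2u(\xi)+u(\xi+1)\big),&\xi\in\Lambda^{\rm a},\\-(k_1+4k_2)\big(u(\xi-1)-2u(\xi)+u(\xi+1)\big),&\xi\in\Lambda^{\rm c},\end{cases}$$ with Dirichlet conditions at $\xi=\pm(N+1)$, and suppose $k_1>0$, $k_2<0$ and $k_1+4k_2>0$. Then the spectral radius $\sigma=\sigma(\mathcal{T})$ of the iteration operator $\mathcal{T}$ of the Sinclair method for this problem (defined in the context) satisfies $\sigma<1$.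
   Context: Let $\mathcal{L}_{\rm hnl}$ act on functions on $\mathbb{Z}$ by $\mathcal{L}_{\rm hnl}[u](\xi)=-k_2(u(\xi-2)-2u(\xi)+u(\xi+2))-k_1(u(\xi-1)-2u(\xi)+u(\xi+1))$ (linearized atomistic model with second-nearest-neighbour interactions) and let $\mathcal{L}_{\rm h}[u](\xi)=-(k_1+4k_2)(u(\xi-1)-2u(\xi)+u(\xi+1))$ (continuum model). For $\mathrm{x},\mathrm{y}\in\{\mathrm{a},\mathrm{c}\}$, the block $\mathcal{L}^{\rm x|y}$ of an operator $\mathcal{L}$ maps a function on $\Lambda^{\rm y}$, extended by zero, to the restriction of its image to $\Lambda^{\rm x}$ (so Dirichlet conditions outside $\Lambda$ are encoded by zero extension of errors). Put $$\mathcal{S}^{\rm c|c}=\mathcal{L}_{\rm h}^{\rm c|c}-\mathcal{L}_{\rm h}^{\rm c|a}(\mathcal{L}_{\rm h}^{\rm a|a})^{-1}\mathcal{L}_{\rm h}^{\rm a|c}.$$ The iteration operator of the Sinclair method, which describes the propagation of the error from one iteration to the next, acts on real-valued functions on $\Lambda$ and is, in block form with respect to (a, c), $$\mathcal{T}=\begin{pmatrix}0&-(\mathcal{L}_{\rm hnl}^{\rm a|a})^{-1}\mathcal{L}_{\rm hnl}^{\rm a|c}\\0&\mathcal{I}^{\rm c|c}-(\mathcal{S}^{\rm c|c})^{-1}\big(\mathcal{L}_{\rm h}^{\rm c|c}-\mathcal{L}_{\rm h}^{\rm c|a}(\mathcal{L}_{\rm hnl}^{\rm a|a})^{-1}\mathcal{L}_{\rm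 hnl}^{\rm a|c}\big)\end{pmatrix},$$ where $\mathcal{I}$ is the identity. *)

theory Defs
  imports "Jordan_Normal_Form.Spectral_Radius"
begin

definition L_hnl :: "real \<Rightarrow> real \<Rightarrow> (int \<Rightarrow> real) \<Rightarrow> int \<Rightarrow> real" where
  "L_hnl k1 k2 u \<xi> =
     - k2 * (u (\<xi> - 2) - 2 * u \<xi> + u (\<xi> + 2)) - k1 * (u (\<xi> - 1) - 2 * u \<xi> + u (\<xi> + 1))"

definition L_h :: "real \<Rightarrow> real \<Rightarrow> (int \<Rightarrow> real) \<Rightarrow> int \<Rightarrow> real" where
  "L_h k1 k2 u \<xi> = - (k1 + 4 * k2) * (u (\<xi> - 1) - 2 * u \<xi> + u (\<xi> + 1))"

definition Lam_a :: "int \<Rightarrow> int set" where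
  "Lam_a M = {-M..M}"

definition Lam_c :: "int \<Rightarrow> int \<Rightarrow> int set" where
  "Lam_c M N = {-N..-M-1} \<union> {M+1..N}"

text \<open>A function on \<open>X\<close> is represented by its extension by zero to all of the integers.\<close>

definition fun_on :: "int set \<Rightarrow> (int \<Rightarrow> real) set" where
  "fun_on X = {u. \<forall>\<xi>. \<xi> \<notin> X \<longrightarrow> u \<xi> = 0}"

definition restr :: "int set \<Rightarrow> (int \<Rightarrow> real) \<Rightarrow> int \<Rightarrow> real" where
  "restr X u = (\<lambda>\<xi>. if \<xi> \<in> X then u \<xi> else 0)"

text \<open>In \<open>block L X Y\<close>, \<open>Y\<close> is the domain and \<open>X\<close> the codomain.\<close>

definition block ::
  "((int \<Rightarrow> real) \<Rightarrow> int \<Rightarrow> real) \<Rightarrow> int set \<Rightarrow> int set \<Rightarrow> (int \<Rightarrow> real) \<Rightarrow> int \<Rightarrow> real" where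
  "block L X Y u = restr X (L (restr Y u))"

text \<open>The inverse of an operator on functions on \<open>X\<close>; it is meaningful where the operator is
  bijective from \<open>fun_on X\<close> to itself.\<close>

definition inv_on ::
  "int set \<Rightarrow> ((int \<Rightarrow> real) \<Rightarrow> int \<Rightarrow> real) \<Rightarrow> (int \<Rightarrow> real) \<Rightarrow> int \<Rightarrow> real" where
  "inv_on X A = the_inv_into (fun_on X) A"

definition L_cpl ::
  "real \<Rightarrow> real \<Rightarrow> int set \<Rightarrow> int set \<Rightarrow> (int \<Rightarrow> real) \<Rightarrow> int \<Rightarrow> real" where
  "L_cpl k1 k2 A C u \<xi> =
     (if \<xi> \<in> A then L_hnl k1 k2 u \<xi> else if \<xi> \<in> C then L_h k1 k2 u \<xi> else 0)"

lemma block_L_cpl: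
  "block (L_cpl k1 k2 A C) A Y = block (L_hnl k1 k2) A Y"
  "A \<inter> C = {} \<Longrightarrow> block (L_cpl k1 k2 A C) C Y = block (L_h k1 k2) C Y"
  by (auto simp: fun_eq_iff block_def restr_def L_cpl_def)

definition schur_c ::
  "real \<Rightarrow> real \<Rightarrow> int set \<Rightarrow> int set \<Rightarrow> (int \<Rightarrow> real) \<Rightarrow> int \<Rightarrow> real" where
  "schur_c k1 k2 A C u =
     (\<lambda>\<xi>. block (L_h k1 k2) C C u \<xi>
        - block (L_h k1 k2) C A (inv_on A (block (L_h k1 k2) A A) (block (L_h k1 k2) A C u)) \<xi>)"

text \<open>The two nonzero blocks of the iteration operator, and the operator itself. Its first
  block column is zero, so only the values of \<open>u\<close> on \<open>C\<close> enter.\<close>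

definition sinclair_ac ::
  "real \<Rightarrow> real \<Rightarrow> int set \<Rightarrow> int set \<Rightarrow> (int \<Rightarrow> real) \<Rightarrow> int \<Rightarrow> real" where
  "sinclair_ac k1 k2 A C u =
     (\<lambda>\<xi>. - inv_on A (block (L_hnl k1 k2) A A) (block (L_hnl k1 k2) A C u) \<xi>)"

definition sinclair_cc ::
  "real \<Rightarrow> real \<Rightarrow> int set \<Rightarrow> int set \<Rightarrow> (int \<Rightarrow> real) \<Rightarrow> int \<Rightarrow> real" where
  "sinclair_cc k1 k2 A C u =
     (\<lambda>\<xi>. u \<xi> - inv_on C (schur_c k1 k2 A C)
        (\<lambda>\<eta>. block (L_h k1 k2) C C u \<eta>
           - block (L_h k1 k2) C A
               (inv_on A (block (L_hnl k1 k2) A A) (block (L_hnl k1 k2) A C u)) \<eta>) \<xi>)"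

definition sinclair_T ::
  "real \<Rightarrow> real \<Rightarrow> int set \<Rightarrow> int set \<Rightarrow> (int \<Rightarrow> real) \<Rightarrow> int \<Rightarrow> real" where
  "sinclair_T k1 k2 A C u =
     (\<lambda>\<xi>. sinclair_ac k1 k2 A C (restr C u) \<xi> + sinclair_cc k1 k2 A C (restr C u) \<xi>)"

text \<open>The matrix of a linear operator on functions on \<open>{-N..N}\<close> in the basis of unit functions,
  with index \<open>i\<close> standing for the lattice site \<open>int i - N\<close>.\<close>

definition op_mat :: "int \<Rightarrow> ((int \<Rightarrow> real) \<Rightarrow> int \<Rightarrow> real) \<Rightarrow> real mat" where
  "op_mat N T = mat (nat (2 * N + 1)) (nat (2 * N + 1))
     (\<lambda>(i, j). T (\<lambda>\<xi>. if \<xi> = int j - N then 1 else 0) (int i - N))"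

text \<open>The spectrum is that of the complexification: complex eigenvalues are included.\<close>

definition op_spectral_radius :: "int \<Rightarrow> ((int \<Rightarrow> real) \<Rightarrow> int \<Rightarrow> real) \<Rightarrow> real" where
  "op_spectral_radius N T = spectral_radius (map_mat complex_of_real (op_mat N T))"

end

theory Submission
  imports Defs "HOL-Library.Function_Algebras"
begin

text \<open>Let \<open>a + b\<i> \<noteq> 0\<close> be an eigenvalue of the iteration operator and \<open>u\<close> the continuum part of an
  eigenvector. Let \<open>V\<close> and \<open>W\<close> be the extensions of \<open>u\<close> to \<open>\<Lambda>\<close> that solve, on the atomistic
  region, the equations of \<open>L_h\<close> and \<open>L_hnl\<close> respectively. With the discrete Laplacian \<open>\<Delta>\<close> the
  eigenvalue equation becomes \<open>\<Delta> W = (1 - a - b\<i>) \<Delta> V\<close> on the continuum region, so \<open>Z = W - V\<close>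
  vanishes there and satisfies \<open>\<Delta> Z = - (a + b\<i>) \<Delta> V\<close>. At the interface this reads
  \<open>Z (\<plusminus>M) = - (a + b\<i>) \<Delta> V (\<plusminus>(M + 1))\<close>. Since
  \<open>L_hnl = - k2 \<Delta>\<^sup>2 - (k1 + 4 k2) \<Delta>\<close>, testing \<open>L_hnl W = 0\<close> with the conjugate of \<open>Z\<close> and summing by
  parts twice gives, for the positive definite energy
  \<open>E(Z) = (k1 + 4 k2) \<Sum>\<bar>\<nabla>Z\<bar>\<^sup>2 - k2 \<Sum>\<bar>\<Delta>Z\<bar>\<^sup>2\<close>,
  the identity \<open>E(Z) = k2 (a\<^sup>2 + b\<^sup>2 - a) (\<bar>\<Delta> V (M + 1)\<bar>\<^sup>2 + \<bar>\<Delta> V (- M - 1)\<bar>\<^sup>2)\<close>. Positivity of \<open>E(Z)\<close>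
  and \<open>k2 < 0\<close> force \<open>a\<^sup>2 + b\<^sup>2 < a\<close>, hence a modulus below 1.\<close>

section \<open>Linear operators on functions supported in a set of sites\<close>

text \<open>Linearity is demanded on \<open>fun_on X\<close> only, because \<open>inv_on\<close> is
  unspecified away from the range of the operator it inverts.\<close>

definition lin_on ::
  "int set \<Rightarrow> int set \<Rightarrow> ((int \<Rightarrow> real) \<Rightarrow> int \<Rightarrow> real) \<Rightarrow> bool" where
  "lin_on X Y A \<longleftrightarrow> (\<forall>u\<in>fun_on X. A u \<in> fun_on Y) \<and>
     (\<forall>u\<in>fun_on X. \<forall>v\<in>fun_on X. \<forall>a b.
        A (\<lambda>\<xi>. a * u \<xi> + b * v \<xi>) = (\<lambda>\<xi>. a * A u \<xi> + b * A v \<xi>))"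

definition unit_fun :: "int \<Rightarrow> int \<Rightarrow> real" where
  "unit_fun j = (\<lambda>\<xi>. if \<xi> = j then 1 else 0)"

lemma fun_on_lincomb:
  "u \<in> fun_on X \<Longrightarrow> v \<in> fun_on X \<Longrightarrow> (\<lambda>\<xi>. a * u \<xi> + b * v \<xi>) \<in> fun_on X"
  by (auto simp: fun_on_def)

lemma fun_on_zero: "(\<lambda>\<xi>. 0) \<in> fun_on X"
  by (auto simp: fun_on_def)

lemma fun_on_mono: "X \<subseteq> Y \<Longrightarrow> fun_on X \<subseteq> fun_on Y"
  by (auto simp: fun_on_def)

lemma restr_in_fun_on: "restr X u \<in> fun_on X"
  by (auto simp: fun_on_def restr_def)

lemma restr_fun_on_eq: "u \<in> fun_on X \<Longrightarrow> restr X u = u"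
  by (auto simp: fun_on_def restr_def fun_eq_iff)

lemma restr_apply: "restr X u \<xi> = (if \<xi> \<in> X then u \<xi> else 0)"
  by (simp add: restr_def)

lemma unit_fun_in_fun_on: "j \<in> X \<Longrightarrow> unit_fun j \<in> fun_on X"
  by (auto simp: fun_on_def unit_fun_def)

lemma lin_onI:
  assumes "\<And>u. u \<in> fun_on X \<Longrightarrow> A u \<in> fun_on Y"
    and "\<And>u v a b \<xi>. u \<in> fun_on X \<Longrightarrow> v \<in> fun_on X \<Longrightarrow>
           A (\<lambda>\<xi>. a * u \<xi> + b * v \<xi>) \<xi> = a * A u \<xi> + b * A v \<xi>"
  shows "lin_on X Y A"
  using assms by (auto simp: lin_on_def fun_eq_iff)

lemma lin_on_range: "lin_on X Y A \<Longrightarrow> u \<in> fun_on X \<Longrightarrow> A u \<in> fun_on Y"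
  by (auto simp: lin_on_def)

lemma lin_on_lincomb:
  "lin_on X Y A \<Longrightarrow> u \<in> fun_on X \<Longrightarrow> v \<in> fun_on X \<Longrightarrow>
     A (\<lambda>\<xi>. a * u \<xi> + b * v \<xi>) = (\<lambda>\<xi>. a * A u \<xi> + b * A v \<xi>)"
  by (auto simp: lin_on_def)

lemma lin_on_zero:
  assumes "lin_on X Y A" shows "A (\<lambda>\<xi>. 0) = (\<lambda>\<xi>. 0)"
  using lin_on_lincomb[OF assms fun_on_zero fun_on_zero, of 0 0] by simp

lemma lin_on_compose:
  assumes "lin_on X Y A" "lin_on Y Z B"
  shows "lin_on X Z (\<lambda>u. B (A u))"
  by (rule lin_onI)
    (auto simp: lin_on_lincomb[OF assms(1)] lin_on_lincomb[OF assms(2)]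
      lin_on_range[OF assms(1)] lin_on_range[OF assms(2)])

lemma lin_on_combine:
  assumes "lin_on X Y A" "lin_on X Y B"
  shows "lin_on X Y (\<lambda>u \<xi>. c * A u \<xi> + d * B u \<xi>)"
  by (rule lin_onI)
    (auto simp: lin_on_lincomb[OF assms(1)] lin_on_lincomb[OF assms(2)] algebra_simps
      intro!: fun_on_lincomb lin_on_range[OF assms(1)] lin_on_range[OF assms(2)])

lemma lin_on_mono:
  assumes "lin_on X Y A" "Y \<subseteq> Z"
  shows "lin_on X Z A"
  using assms fun_on_mono[OF assms(2)] by (auto simp: lin_on_def)

lemma lin_on_restr: "lin_on X Y (restr Y)"
  by (rule lin_onI) (auto simp: restr_in_fun_on, auto simp: restr_def)

lemma lin_on_id: "lin_on X X (\<lambda>u. u)"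
  by (rule lin_onI) auto

lemma lin_on_sum:
  assumes A: "lin_on X Y A" and "finite I" and "\<And>i. i \<in> I \<Longrightarrow> f i \<in> fun_on X"
  shows "A (\<lambda>\<xi>. \<Sum>i\<in>I. c i * f i \<xi>) = (\<lambda>\<xi>. \<Sum>i\<in>I. c i * A (f i) \<xi>)"
  using assms(2,3)
proof (induction I rule: finite_induct)
  case empty
  then show ?case using lin_on_zero[OF A] by simp
next
  case (insert j I)
  have "(\<lambda>\<xi>. \<Sum>i\<in>I. c i * f i \<xi>) \<in> fun_on X"
    using insert.prems by (auto simp: fun_on_def intro!: sum.neutral)
  from lin_on_lincomb[OF A _ this, of "f j" "c j" 1] insert show ?case
    by simp
qed

lemma fun_on_expand:
  assumes "finite X" "u \<in> fun_on X"
  shows "u = (\<lambda>\<xi>. \<Sum>j\<in>X. u j * unit_fun j \<xi>)"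
proof
  fix \<xi>
  have "(\<Sum>j\<in>X. u j * unit_fun j \<xi>) = (\<Sum>j\<in>X. if \<xi> = j then u j else 0)"
    by (rule sum.cong) (auto simp: unit_fun_def)
  also have "\<dots> = u \<xi>"
    using assms by (simp add: sum.delta fun_on_def)
  finally show "u \<xi> = (\<Sum>j\<in>X. u j * unit_fun j \<xi>)" by simp
qed

section \<open>Inverting operators with trivial kernel\<close>

interpretation fs: vector_space "\<lambda>(r::real) (u::int \<Rightarrow> real) \<xi>. r * u \<xi>"
  by unfold_locales (auto simp: fun_eq_iff algebra_simps)

lemma sum_fun_apply: "(\<Sum>i\<in>I. f i) \<xi> = (\<Sum>i\<in>I. (f i :: int \<Rightarrow> real) \<xi>)"
  by (induction I rule: infinite_finite_induct) auto

text \<open>The images of the unit functions are independent, hence by counting they span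
  \<open>fun_on X\<close>.\<close>

lemma lin_on_inj_imp_surj:
  assumes fin: "finite X" and A: "lin_on X X A"
    and ker: "\<And>u. u \<in> fun_on X \<Longrightarrow> A u = (\<lambda>\<xi>. 0) \<Longrightarrow> u = (\<lambda>\<xi>. 0)"
    and b: "b \<in> fun_on X"
  shows "\<exists>u\<in>fun_on X. A u = b"
proof (rule ccontr)
  assume no: "\<not> ?thesis"
  let ?f = "\<lambda>j. A (unit_fun j)"
  have comb: "A (\<lambda>\<xi>. \<Sum>j\<in>X. c j * unit_fun j \<xi>) = (\<lambda>\<xi>. \<Sum>j\<in>X. c j * ?f j \<xi>)" for c
    by (rule lin_on_sum[OF A fin]) (rule unit_fun_in_fun_on)
  have mem: "(\<lambda>\<xi>. \<Sum>j\<in>X. c j * unit_fun j \<xi>) \<in> fun_on X" for c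
    by (auto simp: fun_on_def unit_fun_def intro!: sum.neutral)
  have coeff: "(\<Sum>j\<in>X. c j * unit_fun j i) = c i" if "i \<in> X" for c i
    using fun_on_expand[OF fin restr_in_fun_on, of c, THEN fun_cong, of i] that
    by (simp add: restr_def cong: sum.cong)
  have inj: "inj_on ?f X"
  proof (rule inj_onI)
    fix i j assume ij: "i \<in> X" "j \<in> X" "?f i = ?f j"
    have "A (\<lambda>\<xi>. 1 * unit_fun i \<xi> + (-1) * unit_fun j \<xi>) = (\<lambda>\<xi>. 0)"
      by (subst lin_on_lincomb[OF A unit_fun_in_fun_on[OF ij(1)] unit_fun_in_fun_on[OF ij(2)]])
        (simp add: ij(3))
    from ker[OF fun_on_lincomb[OF unit_fun_in_fun_on[OF ij(1)] unit_fun_in_fun_on[OF ij(2)]] this]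
    show "i = j"
      by (auto simp: fun_eq_iff unit_fun_def split: if_splits)
  qed
  have indep: "fs.independent (?f ` X)"
  proof (rule fs.independent_if_scalars_zero)
    show "finite (?f ` X)" using fin by simp
  next
    fix c x assume s: "(\<Sum>x\<in>?f ` X. (\<lambda>\<xi>. c x * x \<xi>)) = 0" and x: "x \<in> ?f ` X"
    from s have "(\<Sum>j\<in>X. (\<lambda>\<xi>. c (?f j) * ?f j \<xi>)) = 0"
      by (subst (asm) sum.reindex[OF inj]) (simp add: o_def)
    then have "A (\<lambda>\<xi>. \<Sum>j\<in>X. c (?f j) * unit_fun j \<xi>) = (\<lambda>\<xi>. 0)"
      unfolding comb by (simp add: fun_eq_iff sum_fun_apply)
    from ker[OF mem this] have "(\<Sum>j\<in>X. c (?f j) * unit_fun j i) = 0" for i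
      by (simp add: fun_eq_iff)
    with coeff[of _ "\<lambda>j. c (?f j)"] x show "c x = 0" by auto
  qed
  \<comment> \<open>The coefficients of a representation of \<open>b\<close> by the images would
    also be the coefficients of a preimage of \<open>b\<close>.\<close>
  have "b \<notin> fs.span (?f ` X)"
  proof
    assume "b \<in> fs.span (?f ` X)"
    then obtain c where "b = (\<Sum>x\<in>?f ` X. (\<lambda>\<xi>. c x * x \<xi>))"
      using fin by (auto simp: fs.span_finite)
    then have "b = (\<Sum>j\<in>X. (\<lambda>\<xi>. c (?f j) * ?f j \<xi>))"
      by (simp add: sum.reindex[OF inj] o_def)
    then have "A (\<lambda>\<xi>. \<Sum>j\<in>X. c (?f j) * unit_fun j \<xi>) = b"
      unfolding comb by (simp add: fun_eq_iff sum_fun_apply)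
    moreover have "\<forall>u\<in>fun_on X. A u \<noteq> b" using no by simp
    from bspec[OF this mem[of "\<lambda>j. c (?f j)"]]
    have "A (\<lambda>\<xi>. \<Sum>j\<in>X. c (?f j) * unit_fun j \<xi>) \<noteq> b" .
    ultimately show False by (rule notE[rotated])
  qed
  with indep have ind': "fs.independent (insert b (?f ` X))" and nin: "b \<notin> ?f ` X"
    by (auto simp: fs.independent_insert intro: fs.span_base)
  have sub: "fun_on X \<subseteq> fs.span (unit_fun ` X)"
  proof
    fix u assume u: "u \<in> fun_on X"
    have "u = (\<Sum>j\<in>X. (\<lambda>\<xi>. u j * unit_fun j \<xi>))"
      by (subst fun_on_expand[OF fin u]) (simp add: fun_eq_iff sum_fun_apply)
    also have "\<dots> \<in> fs.span (unit_fun ` X)"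
      by (intro fs.span_sum fs.span_scale fs.span_base) auto
    finally show "u \<in> fs.span (unit_fun ` X)" .
  qed
  \<comment> \<open>These are \<open>card X + 1\<close> independent functions in the span of at most
    \<open>card X\<close> unit functions, which is impossible.\<close>
  have "insert b (?f ` X) \<subseteq> fs.span (unit_fun ` X)"
    using b sub lin_on_range[OF A unit_fun_in_fun_on] by blast
  from fs.independent_span_bound[OF _ ind' this] fin
  have "card (insert b (?f ` X)) \<le> card (unit_fun ` X)" by simp
  moreover have "card (insert b (?f ` X)) = Suc (card X)"
    using nin fin inj by (simp add: card_image)
  moreover have "card (unit_fun ` X) \<le> card X" using fin by (rule card_image_le)
  ultimately show False by simp
qed

text \<open>A trivial kernel makes \<open>A\<close> a bijection of \<open>fun_on X\<close>, so
  \<open>the_inv_into\<close> is a genuine inverse there. It is linear because a combination of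
  preimages is a preimage of the combination and preimages are unique.\<close>

lemma
  assumes fin: "finite X" and A: "lin_on X X A"
    and ker: "\<And>u. u \<in> fun_on X \<Longrightarrow> A u = (\<lambda>\<xi>. 0) \<Longrightarrow> u = (\<lambda>\<xi>. 0)"
  shows lin_on_inv_on: "lin_on X X (inv_on X A)"
    and inv_on_right: "b \<in> fun_on X \<Longrightarrow> A (inv_on X A b) = b"
proof -
  have inj: "inj_on A (fun_on X)"
  proof (rule inj_onI)
    fix u v assume uv: "u \<in> fun_on X" "v \<in> fun_on X" "A u = A v"
    have "A (\<lambda>\<xi>. 1 * u \<xi> + (-1) * v \<xi>) = (\<lambda>\<xi>. 0)"
      by (subst lin_on_lincomb[OF A uv(1,2)]) (simp add: uv(3))
    from ker[OF fun_on_lincomb[OF uv(1,2)] this] show "u = v"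
      by (simp add: fun_eq_iff)
  qed
  have img: "A ` fun_on X = fun_on X"
    using lin_on_inj_imp_surj[OF fin A ker] lin_on_range[OF A] by (fastforce simp: image_iff)
  have right: "A (inv_on X A b) = b" if "b \<in> fun_on X" for b
    unfolding inv_on_def by (rule f_the_inv_into_f[OF inj]) (simp add: img that)
  have mem: "inv_on X A b \<in> fun_on X" if "b \<in> fun_on X" for b
    unfolding inv_on_def by (rule the_inv_into_into[OF inj]) (simp_all add: img that)
  show "b \<in> fun_on X \<Longrightarrow> A (inv_on X A b) = b" by (rule right)
  show "lin_on X X (inv_on X A)"
  proof (rule lin_onI[OF mem])
    fix u v :: "int \<Rightarrow> real" and a b \<xi>
    assume u: "u \<in> fun_on X" and v: "v \<in> fun_on X"
    have "A (\<lambda>\<xi>. a * inv_on X A u \<xi> + b * inv_on X A v \<xi>) = (\<lambda>\<xi>. a * u \<xi> + b * v \<xi>)"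
      using lin_on_lincomb[OF A mem[OF u] mem[OF v]] by (simp add: right u v)
    then have "the_inv_into (fun_on X) A (\<lambda>\<xi>. a * u \<xi> + b * v \<xi>)
        = (\<lambda>\<xi>. a * inv_on X A u \<xi> + b * inv_on X A v \<xi>)"
      by (rule the_inv_into_f_eq[OF inj _ fun_on_lincomb[OF mem[OF u] mem[OF v]]])
    then show "inv_on X A (\<lambda>\<xi>. a * u \<xi> + b * v \<xi>) \<xi> = a * inv_on X A u \<xi> + b * inv_on X A v \<xi>"
      by (simp add: inv_on_def)
  qed
qed

lemma block_at: "u \<in> fun_on Y \<Longrightarrow> \<xi> \<in> X \<Longrightarrow> block L X Y u \<xi> = L u \<xi>"
  by (simp add: block_def restr_fun_on_eq) (simp add: restr_def)

section \<open>The discrete Laplacian and summation by parts\<close>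

definition lap :: "(int \<Rightarrow> real) \<Rightarrow> int \<Rightarrow> real" where
  "lap u \<xi> = u (\<xi> - 1) - 2 * u \<xi> + u (\<xi> + 1)"

lemma L_h_lap: "L_h k1 k2 u \<xi> = - (k1 + 4 * k2) * lap u \<xi>"
  by (simp add: L_h_def lap_def)

text \<open>The second-neighbour difference equals \<open>lap (lap u) + 4 * lap u\<close>. The
  second-order part thus carries the same coefficient as \<open>L_h\<close>, which makes the two
  models comparable.\<close>

lemma L_hnl_lap: "L_hnl k1 k2 u \<xi> = - k2 * lap (lap u) \<xi> - (k1 + 4 * k2) * lap u \<xi>"
  by (simp add: L_hnl_def lap_def algebra_simps)

lemma lin_on_block_L_h: "lin_on Y X (block (L_h k1 k2) X Y)"
  by (rule lin_onI) (auto simp: block_def restr_in_fun_on, auto simp: restr_def L_h_def algebra_simps)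

lemma lin_on_block_L_hnl: "lin_on Y X (block (L_hnl k1 k2) X Y)"
  by (rule lin_onI) (auto simp: block_def restr_in_fun_on, auto simp: restr_def L_hnl_def algebra_simps)

text \<open>The summands telescope: at each site they add up to the increment of
  \<open>u \<xi> * (v \<xi> - v (\<xi> - 1))\<close> from \<open>\<xi>\<close> to
  \<open>\<xi> + 1\<close>.\<close>

lemma green_first:
  fixes u v :: "int \<Rightarrow> real"
  assumes "a \<le> b"
  shows "(\<Sum>\<xi>\<in>{a..b}. u \<xi> * lap v \<xi>) + (\<Sum>\<xi>\<in>{a..b}. (u (\<xi> + 1) - u \<xi>) * (v (\<xi> + 1) - v \<xi>))
    = u (b + 1) * (v (b + 1) - v b) - u a * (v a - v (a - 1))"
  using assms
proof (induction b rule: int_ge_induct)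
  case base
  then show ?case by (simp add: lap_def algebra_simps)
next
  case (step i)
  have "{a..i + 1} = insert (i + 1) {a..i}" using step.hyps by auto
  then show ?case using step.IH by (simp add: lap_def algebra_simps)
qed

text \<open>The gradient sums include the bond from \<open>-m-1\<close> to \<open>-m\<close>,
  whereas the Laplacian sums start at \<open>-m\<close>; this splits off the extra site.\<close>

lemma sum_cons_int:
  "m \<ge> 0 \<Longrightarrow> (\<Sum>\<xi>\<in>{-m-1..m}. f \<xi>) = f (-m-1) + (\<Sum>\<xi>\<in>{-m..m::int}. f \<xi> :: real)"
proof -
  assume "m \<ge> 0"
  then have "{-m-1..m} = insert (-m-1) {-m..m}" by auto
  then show ?thesis by simp
qed

lemma green_dirichlet:
  fixes u v :: "int \<Rightarrow> real"
  assumes "m \<ge> 0" "u (m + 1) = 0" "u (-m-1) = 0"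
  shows "(\<Sum>\<xi>\<in>{-m..m}. u \<xi> * lap v \<xi>) = - (\<Sum>\<xi>\<in>{-m-1..m}. (u (\<xi> + 1) - u \<xi>) * (v (\<xi> + 1) - v \<xi>))"
  using green_first[of "-m-1" m u v] assms sum_cons_int[of m "\<lambda>\<xi>. u \<xi> * lap v \<xi>"] by simp

text \<open>Green's first identity is used with both orders of the two functions and the gradient
  sums cancel. The function \<open>g\<close> is unrestricted at the boundary, so its exterior values
  survive in the interface terms.\<close>

lemma green_second:
  fixes u g :: "int \<Rightarrow> real"
  assumes "m \<ge> 0" "u (m + 1) = 0" "u (-m-1) = 0"
  shows "(\<Sum>\<xi>\<in>{-m..m}. u \<xi> * lap g \<xi>)
    = (\<Sum>\<xi>\<in>{-m..m}. g \<xi> * lap u \<xi>) + g (m + 1) * u m + g (-m-1) * u (-m)"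
proof -
  have "(\<Sum>\<xi>\<in>{-m-1..m}. g \<xi> * lap u \<xi>) + (\<Sum>\<xi>\<in>{-m-1..m}. (g (\<xi> + 1) - g \<xi>) * (u (\<xi> + 1) - u \<xi>))
    = - g (m + 1) * u m + g (-m-1) * u (-m-1-1)"
    using green_first[of "-m-1" m g u] assms by simp
  moreover have "(\<Sum>\<xi>\<in>{-m-1..m}. (g (\<xi> + 1) - g \<xi>) * (u (\<xi> + 1) - u \<xi>))
    = (\<Sum>\<xi>\<in>{-m-1..m}. (u (\<xi> + 1) - u \<xi>) * (g (\<xi> + 1) - g \<xi>))"
    by (simp add: mult.commute)
  \<comment> \<open>The value \<open>u (-m-1-1)\<close> appearing here cancels the one in the
    boundary term above.\<close>
  moreover have "g (-m-1) * lap u (-m-1) = g (-m-1) * (u (-m-1-1) + u (-m))"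
    using assms by (simp add: lap_def)
  ultimately show ?thesis
    using green_dirichlet[OF assms, of g] sum_cons_int[OF assms(1), of "\<lambda>\<xi>. g \<xi> * lap u \<xi>"]
    by (simp add: distrib_left)
qed

section \<open>Energy identity and uniqueness for the Dirichlet problems\<close>

lemma gradient_zero_imp_zero:
  fixes u :: "int \<Rightarrow> real"
  assumes u0: "u a = 0" and grad: "(\<Sum>\<xi>\<in>{a..b}. (u (\<xi> + 1) - u \<xi>)\<^sup>2) \<le> 0"
    and \<xi>: "a \<le> \<xi>" "\<xi> \<le> b + 1"
  shows "u \<xi> = 0"
proof -
  have "(\<Sum>\<xi>\<in>{a..b}. (u (\<xi> + 1) - u \<xi>)\<^sup>2) = 0"
    using grad by (simp add: antisym sum_nonneg)
  then have grad_step: "u (\<eta> + 1) = u \<eta>" if "\<eta> \<in> {a..b}" for \<eta>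
    using that by (simp add: sum_nonneg_eq_0_iff)
  show ?thesis using \<xi>
  proof (induction \<xi> rule: int_ge_induct)
    case base
    then show ?case using u0 by simp
  next
    case (step i)
    then show ?case using grad_step[of i] by simp
  qed
qed

lemma fun_on_gradient_zero:
  assumes "u \<in> fun_on {-m..m}" and "(\<Sum>\<xi>\<in>{-m-1..m}. (u (\<xi> + 1) - u \<xi>)\<^sup>2) \<le> 0"
  shows "u = (\<lambda>\<xi>. 0)"
proof
  fix \<xi>
  have "u (-m-1) = 0" using assms(1) by (simp add: fun_on_def)
  from gradient_zero_imp_zero[OF this assms(2), of \<xi>] show "u \<xi> = 0"
    using assms(1) by (cases "\<xi> \<in> {-m..m}") (auto simp: fun_on_def)
qed

lemma lap_kernel:
  assumes "m \<ge> 0" and u: "u \<in> fun_on {-m..m}"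
    and "\<And>\<xi>. \<xi> \<in> {-m..m} \<Longrightarrow> lap u \<xi> = 0"
  shows "u = (\<lambda>\<xi>. 0)"
proof (rule fun_on_gradient_zero[OF u])
  have "u (m + 1) = 0" "u (-m-1) = 0" using u by (simp_all add: fun_on_def)
  from green_dirichlet[OF assms(1) this, of u] assms(3)
  show "(\<Sum>\<xi>\<in>{-m-1..m}. (u (\<xi> + 1) - u \<xi>)\<^sup>2) \<le> 0"
    by (simp add: power2_eq_square)
qed

text \<open>The equation for \<open>W\<close> is tested with \<open>Z\<close>, and one Laplacian of
  the fourth-order term is moved onto \<open>Z\<close>. The two functions need equal Laplacians only
  inside, so at the exterior sites \<open>lap W\<close> remains.\<close>

lemma L_hnl_energy:
  fixes Z W :: "int \<Rightarrow> real"
  assumes "m \<ge> 0" and Z: "Z (m + 1) = 0" "Z (-m-1) = 0"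
    and W: "\<And>\<xi>. \<xi> \<in> {-m..m} \<Longrightarrow> L_hnl k1 k2 W \<xi> = 0"
    and ZW: "\<And>\<xi>. \<xi> \<in> {-m..m} \<Longrightarrow> lap W \<xi> = lap Z \<xi>"
  shows "(k1 + 4 * k2) * (\<Sum>\<xi>\<in>{-m-1..m}. (Z (\<xi> + 1) - Z \<xi>)\<^sup>2)
    - k2 * ((\<Sum>\<xi>\<in>{-m..m}. (lap Z \<xi>)\<^sup>2) + lap W (m + 1) * Z m + lap W (-m-1) * Z (-m)) = 0"
proof -
  have "0 = (\<Sum>\<xi>\<in>{-m..m}. Z \<xi> * L_hnl k1 k2 W \<xi>)"
    using W by simp
  also have "\<dots> = - k2 * (\<Sum>\<xi>\<in>{-m..m}. Z \<xi> * lap (lap W) \<xi>)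
      - (k1 + 4 * k2) * (\<Sum>\<xi>\<in>{-m..m}. Z \<xi> * lap W \<xi>)"
    by (simp add: L_hnl_lap sum_subtractf[symmetric] sum_negf[symmetric] sum_distrib_left)
      (simp add: algebra_simps)
  also have "(\<Sum>\<xi>\<in>{-m..m}. Z \<xi> * lap W \<xi>) = (\<Sum>\<xi>\<in>{-m..m}. Z \<xi> * lap Z \<xi>)"
    using ZW by simp
  also have "\<dots> = - (\<Sum>\<xi>\<in>{-m-1..m}. (Z (\<xi> + 1) - Z \<xi>)\<^sup>2)"
    using green_dirichlet[OF assms(1) Z, of Z] by (simp add: power2_eq_square)
  also have "(\<Sum>\<xi>\<in>{-m..m}. Z \<xi> * lap (lap W) \<xi>)
     = (\<Sum>\<xi>\<in>{-m..m}. (lap Z \<xi>)\<^sup>2) + lap W (m + 1) * Z m + lap W (-m-1) * Z (-m)"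
    using green_second[OF assms(1) Z, of "lap W"] ZW by (simp add: power2_eq_square)
  finally show ?thesis by simp
qed

text \<open>With \<open>Z = W = u\<close> in the energy identity the interface products become
  squares, and the signs of the coefficients leave no room for a nonzero gradient.\<close>

lemma L_hnl_kernel:
  assumes "m \<ge> 0" and k: "k2 < 0" "k1 + 4 * k2 > 0" and u: "u \<in> fun_on {-m..m}"
    and L: "\<And>\<xi>. \<xi> \<in> {-m..m} \<Longrightarrow> L_hnl k1 k2 u \<xi> = 0"
  shows "u = (\<lambda>\<xi>. 0)"
proof (rule fun_on_gradient_zero[OF u])
  have z: "u (m + 1) = 0" "u (-m-1) = 0" "u (m + 2) = 0" "u (-m-2) = 0"
    using u by (simp_all add: fun_on_def)
  \<comment> \<open>Zero extension also kills \<open>u\<close> one site further out, so the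
    Laplacian at the first exterior site is the adjacent interior value.\<close>
  have "lap u (m + 1) = u m" "lap u (-m-1) = u (-m)"
    using z by (simp_all add: lap_def algebra_simps)
  with L_hnl_energy[OF assms(1) z(1,2) L]
  have "(k1 + 4 * k2) * (\<Sum>\<xi>\<in>{-m-1..m}. (u (\<xi> + 1) - u \<xi>)\<^sup>2)
     = k2 * ((\<Sum>\<xi>\<in>{-m..m}. (lap u \<xi>)\<^sup>2) + u m * u m + u (-m) * u (-m))" by simp
  also have "\<dots> \<le> 0"
    using k by (intro mult_nonpos_nonneg add_nonneg_nonneg sum_nonneg) auto
  finally show "(\<Sum>\<xi>\<in>{-m-1..m}. (u (\<xi> + 1) - u \<xi>)\<^sup>2) \<le> 0"
    using k by (simp add: mult_le_0_iff)
qed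

section \<open>Complex products in real coordinates\<close>

text \<open>The hypotheses are the real and imaginary parts of
  \<open>(a + ib) (p + iq) = 0\<close>.\<close>

lemma rotation_scaling_kernel:
  fixes a b p q :: real
  assumes "a * p - b * q = 0" "a * q + b * p = 0" and "a\<^sup>2 + b\<^sup>2 \<noteq> 0"
  shows "p = 0 \<and> q = 0"
proof -
  have "(a\<^sup>2 + b\<^sup>2) * p = a * (a * p - b * q) + b * (a * q + b * p)"
    "(a\<^sup>2 + b\<^sup>2) * q = a * (a * q + b * p) - b * (a * p - b * q)"
    by (simp_all add: power2_eq_square algebra_simps)
  with assms show ?thesis by auto
qed

text \<open>For \<lambda> = a + ib and \<zeta> = \<alpha> + i\<beta>, the left side is the real part
  of (1 - \<lambda>)\<zeta> times the conjugate of -\<lambda>\<zeta>.\<close>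

lemma boundary_algebra:
  fixes a b \<alpha> \<beta> :: real
  shows "((1 - a) * \<alpha> + b * \<beta>) * (b * \<beta> - a * \<alpha>) + ((1 - a) * \<beta> - b * \<alpha>) * (- b * \<alpha> - a * \<beta>)
    = (a\<^sup>2 + b\<^sup>2 - a) * (\<alpha>\<^sup>2 + \<beta>\<^sup>2)"
  by (simp add: power2_eq_square algebra_simps)

section \<open>Extensions into the atomistic region and the Schur complement\<close>

locale sinclair =
  fixes M N :: int and k1 k2 :: real
  assumes M: "M \<ge> 1" and N: "N \<ge> M + 2"
    and k2: "k2 < 0" and k: "k1 + 4 * k2 > 0"
begin

abbreviation "A \<equiv> Lam_a M"
abbreviation "C \<equiv> Lam_c M N"
abbreviation "harm_inv \<equiv> inv_on A (block (L_h k1 k2) A A)"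
abbreviation "hnl_inv \<equiv> inv_on A (block (L_hnl k1 k2) A A)"

definition V :: "(int \<Rightarrow> real) \<Rightarrow> int \<Rightarrow> real" where
  "V u = (\<lambda>\<xi>. u \<xi> - harm_inv (block (L_h k1 k2) A C u) \<xi>)"

text \<open>For \<open>u\<close> supported in \<open>C\<close>, the values on \<open>A\<close> are
  those of \<open>sinclair_ac\<close>, the atomistic component of the iteration.\<close>

definition W :: "(int \<Rightarrow> real) \<Rightarrow> int \<Rightarrow> real" where
  "W u = (\<lambda>\<xi>. u \<xi> - hnl_inv (block (L_hnl k1 k2) A C u) \<xi>)"

lemma finite_AC: "finite A" "finite C"
  by (auto simp: Lam_a_def Lam_c_def)

lemma AC: "A \<inter> C = {}" "A \<union> C = {-N..N}"
  using M N by (auto simp: Lam_a_def Lam_c_def)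

lemma block_eqI:
  assumes "block L X Y u = (\<lambda>\<xi>. 0)" "u \<in> fun_on Y" "\<xi> \<in> X"
  shows "L u \<xi> = 0"
  using fun_cong[OF assms(1), of \<xi>] by (simp add: block_at assms(2,3))

lemma ker_h:
  assumes "u \<in> fun_on A" "block (L_h k1 k2) A A u = (\<lambda>\<xi>. 0)"
  shows "u = (\<lambda>\<xi>. 0)"
proof (rule lap_kernel[of M])
  show "M \<ge> 0" using M by simp
  show "u \<in> fun_on {-M..M}" using assms(1) by (simp add: Lam_a_def)
  show "lap u \<xi> = 0" if "\<xi> \<in> {-M..M}" for \<xi>
    using block_eqI[OF assms(2,1), of \<xi>] that k by (simp add: Lam_a_def L_h_lap)
qed

lemma ker_hnl:
  assumes "u \<in> fun_on A" "block (L_hnl k1 k2) A A u = (\<lambda>\<xi>. 0)"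
  shows "u = (\<lambda>\<xi>. 0)"
proof (rule L_hnl_kernel[of M, OF _ k2 k])
  show "M \<ge> 0" using M by simp
  show "u \<in> fun_on {-M..M}" using assms(1) by (simp add: Lam_a_def)
  show "L_hnl k1 k2 u \<xi> = 0" if "\<xi> \<in> {-M..M}" for \<xi>
    using block_eqI[OF assms(2,1), of \<xi>] that by (simp add: Lam_a_def)
qed

lemma lin_harm_inv: "lin_on A A (harm_inv)"
  by (rule lin_on_inv_on[OF finite_AC(1) lin_on_block_L_h]) (rule ker_h)

lemma harm_inv_right: "b \<in> fun_on A \<Longrightarrow> block (L_h k1 k2) A A (harm_inv b) = b"
  by (rule inv_on_right[OF finite_AC(1) lin_on_block_L_h]) (rule ker_h)

lemma lin_hnl_inv: "lin_on A A (hnl_inv)"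
  by (rule lin_on_inv_on[OF finite_AC(1) lin_on_block_L_hnl]) (rule ker_hnl)

lemma hnl_inv_right: "b \<in> fun_on A \<Longrightarrow> block (L_hnl k1 k2) A A (hnl_inv b) = b"
  by (rule inv_on_right[OF finite_AC(1) lin_on_block_L_hnl]) (rule ker_hnl)

lemmas lin_harm = lin_on_compose[OF lin_on_block_L_h[of C A k1 k2] lin_harm_inv]
lemmas lin_hnl = lin_on_compose[OF lin_on_block_L_hnl[of C A k1 k2] lin_hnl_inv]

lemma V_C: assumes "u \<in> fun_on C" "\<xi> \<notin> A" shows "V u \<xi> = u \<xi>"
  using lin_on_range[OF lin_harm assms(1)] assms(2) by (simp add: V_def fun_on_def)

lemma W_C: assumes "u \<in> fun_on C" "\<xi> \<notin> A" shows "W u \<xi> = u \<xi>"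
  using lin_on_range[OF lin_hnl assms(1)] assms(2) by (simp add: W_def fun_on_def)

lemma V_harmonic:
  assumes u: "u \<in> fun_on C" and \<xi>: "\<xi> \<in> A"
  shows "lap (V u) \<xi> = 0"
proof -
  let ?w = "harm_inv (block (L_h k1 k2) A C u)"
  have w: "?w \<in> fun_on A" by (rule lin_on_range[OF lin_harm u])
  have "block (L_h k1 k2) A A ?w \<xi> = block (L_h k1 k2) A C u \<xi>"
    by (simp add: harm_inv_right lin_on_range[OF lin_on_block_L_h u])
  then have "L_h k1 k2 ?w \<xi> = L_h k1 k2 u \<xi>"
    using \<xi> by (simp only: block_at w u)
  then have "lap ?w \<xi> = lap u \<xi>" using k by (simp add: L_h_lap)
  then show ?thesis by (simp add: V_def lap_def)
qed

lemma W_hnl: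
  assumes u: "u \<in> fun_on C" and \<xi>: "\<xi> \<in> A"
  shows "L_hnl k1 k2 (W u) \<xi> = 0"
proof -
  let ?w = "hnl_inv (block (L_hnl k1 k2) A C u)"
  have w: "?w \<in> fun_on A" by (rule lin_on_range[OF lin_hnl u])
  have "block (L_hnl k1 k2) A A ?w \<xi> = block (L_hnl k1 k2) A C u \<xi>"
    by (simp add: hnl_inv_right lin_on_range[OF lin_on_block_L_hnl u])
  then have "L_hnl k1 k2 ?w \<xi> = L_hnl k1 k2 u \<xi>"
    using \<xi> by (simp only: block_at w u)
  then show ?thesis by (simp add: W_def L_hnl_def algebra_simps)
qed

text \<open>This is the common form of the Schur complement and of the residual in
  \<open>sinclair_cc\<close>: each is \<open>L_h\<close> on \<open>C\<close> applied to an extension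
  of \<open>u\<close>, namely \<open>V u\<close> or \<open>W u\<close>.\<close>

lemma block_combine:
  assumes "u \<in> fun_on C" "w \<in> fun_on A" "\<xi> \<in> C"
  shows "block (L_h k1 k2) C C u \<xi> - block (L_h k1 k2) C A w \<xi>
    = - (k1 + 4 * k2) * lap (\<lambda>\<xi>. u \<xi> - w \<xi>) \<xi>"
  using assms(3)
  by (simp only: block_at assms(1,2) L_h_lap) (simp add: lap_def algebra_simps)

lemma schur_V:
  assumes "u \<in> fun_on C" "\<xi> \<in> C"
  shows "schur_c k1 k2 A C u \<xi> = - (k1 + 4 * k2) * lap (V u) \<xi>"
  unfolding schur_c_def V_def
  by (rule block_combine[OF assms(1) lin_on_range[OF lin_harm assms(1)] assms(2)])

lemma lin_schur: "lin_on C C (schur_c k1 k2 A C)"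
  using lin_on_combine[OF lin_on_block_L_h[of C C k1 k2]
      lin_on_compose[OF lin_harm lin_on_block_L_h[of A C k1 k2]], where c = 1 and d = "-1"]
  by (simp add: schur_c_def[abs_def])

text \<open>\<open>V u\<close> is harmonic on \<open>A\<close> by construction and on
  \<open>C\<close> by hypothesis, so it solves the homogeneous Dirichlet problem on all of
  \<open>{-N..N}\<close>. This gives invertibility of the Schur complement and later excludes zero
  energy.\<close>

lemma V_zero:
  assumes u: "u \<in> fun_on C" and h: "\<And>\<xi>. \<xi> \<in> C \<Longrightarrow> lap (V u) \<xi> = 0"
  shows "u = (\<lambda>\<xi>. 0)"
proof -
  have "V u = (\<lambda>\<xi>. 0)"
  proof (rule lap_kernel[of N])
    show "N \<ge> 0" using M N by simp
    show "V u \<in> fun_on {-N..N}"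
      using V_C[OF u] u by (auto simp: fun_on_def AC(2)[symmetric])
    show "lap (V u) \<xi> = 0" if "\<xi> \<in> {-N..N}" for \<xi>
      using that h V_harmonic[OF u] by (auto simp: AC(2)[symmetric])
  qed
  then show ?thesis
    using V_C[OF u] u AC(1) by (fastforce simp: fun_on_def fun_eq_iff)
qed

lemma ker_schur:
  assumes u: "u \<in> fun_on C" and "schur_c k1 k2 A C u = (\<lambda>\<xi>. 0)"
  shows "u = (\<lambda>\<xi>. 0)"
  using V_zero[OF u] schur_V[OF u] assms(2) k by simp

lemma lin_schur_inv: "lin_on C C (inv_on C (schur_c k1 k2 A C))"
  by (rule lin_on_inv_on[OF finite_AC(2) lin_schur]) (rule ker_schur)

lemma schur_inv_right: "b \<in> fun_on C \<Longrightarrow> schur_c k1 k2 A C (inv_on C (schur_c k1 k2 A C) b) = b"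
  by (rule inv_on_right[OF finite_AC(2) lin_schur]) (rule ker_schur)

text \<open>The continuum residual after the atomistic solve, to which \<open>sinclair_cc\<close>
  applies the inverse Schur complement.\<close>

abbreviation "R u \<equiv> (\<lambda>\<eta>. block (L_h k1 k2) C C u \<eta>
   - block (L_h k1 k2) C A (hnl_inv (block (L_hnl k1 k2) A C u)) \<eta>)"

lemma lin_R: "lin_on C C (\<lambda>u. R u)"
  using lin_on_combine[OF lin_on_block_L_h[of C C k1 k2]
      lin_on_compose[OF lin_hnl lin_on_block_L_h[of A C k1 k2]], where c = 1 and d = "-1"]
  by simp

lemma R_W:
  assumes "u \<in> fun_on C" "\<xi> \<in> C"
  shows "R u \<xi> = - (k1 + 4 * k2) * lap (W u) \<xi>"
  unfolding W_def
  by (rule block_combine[OF assms(1) lin_on_range[OF lin_hnl assms(1)] assms(2)])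

lemma lin_cc: "lin_on C C (sinclair_cc k1 k2 A C)"
  using lin_on_combine[OF lin_on_id lin_on_compose[OF lin_R lin_schur_inv], where c = 1 and d = "-1"]
  by (simp add: sinclair_cc_def[abs_def])

lemma lin_ac: "lin_on C A (sinclair_ac k1 k2 A C)"
  using lin_on_combine[OF lin_hnl lin_hnl, where c = "-1" and d = 0]
  by (simp add: sinclair_ac_def[abs_def])

lemma lin_T: "lin_on {-N..N} {-N..N} (sinclair_T k1 k2 A C)"
proof -
  have "A \<subseteq> {-N..N}" "C \<subseteq> {-N..N}" using AC(2) by auto
  note ac = lin_on_mono[OF lin_on_compose[OF lin_on_restr lin_ac] this(1)]
    and cc = lin_on_mono[OF lin_on_compose[OF lin_on_restr lin_cc] this(2)]
  from lin_on_combine[OF ac cc, where c = 1 and d = 1] show ?thesis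
    by (simp add: sinclair_T_def[abs_def])
qed

text \<open>Applying the Schur complement to the equation removes its inverse and leaves Laplacians
  of extensions. This is one real component of the eigenvalue equation; the sign of \<open>b\<close>
  and the order of \<open>u\<close> and \<open>v\<close> select which.\<close>

lemma schur_cc:
  assumes u: "u \<in> fun_on C" and v: "v \<in> fun_on C"
    and cc: "sinclair_cc k1 k2 A C u = (\<lambda>\<xi>. a * u \<xi> + b * v \<xi>)" and \<xi>: "\<xi> \<in> C"
  shows "lap (W u) \<xi> = (1 - a) * lap (V u) \<xi> - b * lap (V v) \<xi>"
proof -
  let ?S = "schur_c k1 k2 A C"
  have Ru: "R u \<in> fun_on C" by (rule lin_on_range[OF lin_R u])
  have "inv_on C ?S (R u) = (\<lambda>\<xi>. (1 - a) * u \<xi> + (- b) * v \<xi>)"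
    using cc by (auto simp: sinclair_cc_def fun_eq_iff algebra_simps)
  then have "?S (\<lambda>\<xi>. (1 - a) * u \<xi> + (- b) * v \<xi>) = R u"
    using schur_inv_right[OF Ru] by simp
  then have "(\<lambda>\<xi>. (1 - a) * ?S u \<xi> + (- b) * ?S v \<xi>) = R u"
    by (simp only: lin_on_lincomb[OF lin_schur u v])
  from fun_cong[OF this, of \<xi>]
  have "(1 - a) * (- (k1 + 4 * k2) * lap (V u) \<xi>) + (- b) * (- (k1 + 4 * k2) * lap (V v) \<xi>)
     = - (k1 + 4 * k2) * lap (W u) \<xi>"
    by (simp only: schur_V[OF u \<xi>] schur_V[OF v \<xi>] R_W[OF u \<xi>])
  then have "(k1 + 4 * k2) * ((1 - a) * lap (V u) \<xi> - b * lap (V v) \<xi>) = (k1 + 4 * k2) * lap (W u) \<xi>"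
    by (simp add: algebra_simps)
  then show ?thesis using k by simp
qed

section \<open>The energy identity at an eigenvector\<close>

definition Z :: "(int \<Rightarrow> real) \<Rightarrow> int \<Rightarrow> real" where
  "Z u = (\<lambda>\<xi>. W u \<xi> - V u \<xi>)"

lemma lap_Z: "lap (Z u) \<xi> = lap (W u) \<xi> - lap (V u) \<xi>"
  by (simp add: Z_def lap_def)

lemma Z_in: assumes "u \<in> fun_on C" shows "Z u \<in> fun_on {-M..M}"
  using V_C[OF assms] W_C[OF assms] by (auto simp: fun_on_def Z_def Lam_a_def)

text \<open>\<open>Z u\<close> vanishes at \<open>M + 1\<close> and \<open>M + 2\<close>, so only
  the inner neighbour contributes to the Laplacian; likewise on the left. The interface values are
  thereby tied to sites of \<open>C\<close>, where the eigenvalue equation holds.\<close>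

lemma Z_boundary:
  assumes u: "u \<in> fun_on C"
  shows "Z u M = lap (Z u) (M + 1)" "Z u (- M) = lap (Z u) (- M - 1)"
  using Z_in[OF u] M by (simp_all add: lap_def fun_on_def)

text \<open>The squared Laplacians are summed over the interior only; the interface contributions
  form the right side of \<open>energy_identity\<close>.\<close>

definition energy :: "(int \<Rightarrow> real) \<Rightarrow> real" where
  "energy u = (k1 + 4 * k2) * (\<Sum>\<xi>\<in>{-M-1..M}. (Z u (\<xi> + 1) - Z u \<xi>)\<^sup>2)
     - k2 * (\<Sum>\<xi>\<in>{-M..M}. (lap (Z u) \<xi>)\<^sup>2)"

lemma energy_nonneg: "energy u \<ge> 0"
proof -
  have "- k2 * (\<Sum>\<xi>\<in>{-M..M}. (lap (Z u) \<xi>)\<^sup>2) \<ge> 0"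
    using k2 by (intro mult_nonneg_nonneg sum_nonneg) auto
  moreover have "(k1 + 4 * k2) * (\<Sum>\<xi>\<in>{-M-1..M}. (Z u (\<xi> + 1) - Z u \<xi>)\<^sup>2) \<ge> 0"
    using k by (intro mult_nonneg_nonneg sum_nonneg) auto
  ultimately show ?thesis unfolding energy_def by linarith
qed

lemma energy_zero:
  assumes u: "u \<in> fun_on C" and "energy u \<le> 0"
  shows "Z u = (\<lambda>\<xi>. 0)"
proof (rule fun_on_gradient_zero[OF Z_in[OF u]])
  have "- k2 * (\<Sum>\<xi>\<in>{-M..M}. (lap (Z u) \<xi>)\<^sup>2) \<ge> 0"
    using k2 by (intro mult_nonneg_nonneg sum_nonneg) auto
  with assms(2) have "(k1 + 4 * k2) * (\<Sum>\<xi>\<in>{-M-1..M}. (Z u (\<xi> + 1) - Z u \<xi>)\<^sup>2) \<le> 0"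
    unfolding energy_def by linarith
  then show "(\<Sum>\<xi>\<in>{-M-1..M}. (Z u (\<xi> + 1) - Z u \<xi>)\<^sup>2) \<le> 0"
    using k by (simp add: mult_le_0_iff)
qed

text \<open>\<open>L_hnl_energy\<close> applies to \<open>Z u\<close> and \<open>W u\<close>, whose
  Laplacians agree on \<open>A\<close> because \<open>V u\<close> is harmonic there.\<close>

lemma energy_identity:
  assumes u: "u \<in> fun_on C"
  shows "energy u = k2 * (lap (W u) (M + 1) * Z u M + lap (W u) (- M - 1) * Z u (- M))"
proof -
  have z: "Z u (M + 1) = 0" "Z u (- M - 1) = 0" "M \<ge> 0"
    using Z_in[OF u] M by (simp_all add: fun_on_def)
  have "L_hnl k1 k2 (W u) \<xi> = 0" "lap (W u) \<xi> = lap (Z u) \<xi>" if "\<xi> \<in> {-M..M}" for \<xi>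
    using W_hnl[OF u, of \<xi>] V_harmonic[OF u, of \<xi>] that by (simp_all add: lap_Z Lam_a_def)
  from L_hnl_energy[OF z(3,1,2) this] show ?thesis
    by (simp add: energy_def algebra_simps)
qed

text \<open>Here \<open>x\<close> and \<open>y\<close> are the real and imaginary part of an eigenvector of the second
  diagonal block for the eigenvalue \<open>a + b\<i>\<close>.\<close>

lemma cc_eigen:
  assumes x: "x \<in> fun_on C" and y: "y \<in> fun_on C"
    and cx: "sinclair_cc k1 k2 A C x = (\<lambda>\<xi>. a * x \<xi> + (- b) * y \<xi>)"
    and cy: "sinclair_cc k1 k2 A C y = (\<lambda>\<xi>. a * y \<xi> + b * x \<xi>)"
    and nz: "\<not> (x = (\<lambda>\<xi>. 0) \<and> y = (\<lambda>\<xi>. 0))" and ab: "a\<^sup>2 + b\<^sup>2 \<noteq> 0"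
  shows "a\<^sup>2 + b\<^sup>2 < a"
proof -
  have in_C: "M + 1 \<in> C" "- M - 1 \<in> C" using M N by (auto simp: Lam_c_def)
  \<comment> \<open>\<open>S\<close> is the sum of the squared moduli of the Laplacian of
    \<open>V x + i V y\<close> at the two interface sites of \<open>C\<close>.\<close>
  define S where "S = (lap (V x) (M + 1))\<^sup>2 + (lap (V y) (M + 1))\<^sup>2
     + ((lap (V x) (- M - 1))\<^sup>2 + (lap (V y) (- M - 1))\<^sup>2)"
  have Wx: "lap (W x) \<xi> = (1 - a) * lap (V x) \<xi> + b * lap (V y) \<xi>"
    and Wy: "lap (W y) \<xi> = (1 - a) * lap (V y) \<xi> - b * lap (V x) \<xi>" if "\<xi> \<in> C" for \<xi>
    using schur_cc[OF x y cx that] schur_cc[OF y x cy that] by simp_all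
  have Zx: "lap (Z x) \<xi> = b * lap (V y) \<xi> - a * lap (V x) \<xi>"
    and Zy: "lap (Z y) \<xi> = - b * lap (V x) \<xi> - a * lap (V y) \<xi>" if "\<xi> \<in> C" for \<xi>
    using Wx[OF that] Wy[OF that] by (simp_all add: lap_Z algebra_simps)
  have "energy x + energy y = k2 *
      ((lap (W x) (M + 1) * lap (Z x) (M + 1) + lap (W y) (M + 1) * lap (Z y) (M + 1))
     + (lap (W x) (- M - 1) * lap (Z x) (- M - 1) + lap (W y) (- M - 1) * lap (Z y) (- M - 1)))"
    by (simp add: energy_identity x y Z_boundary algebra_simps)
  also have "\<dots> = k2 * ((a\<^sup>2 + b\<^sup>2 - a) * S)"
    unfolding Wx[OF in_C(1)] Wx[OF in_C(2)] Wy[OF in_C(1)] Wy[OF in_C(2)]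
      Zx[OF in_C(1)] Zx[OF in_C(2)] Zy[OF in_C(1)] Zy[OF in_C(2)] boundary_algebra S_def
    by (simp only: distrib_left)
  finally have E: "energy x + energy y = k2 * ((a\<^sup>2 + b\<^sup>2 - a) * S)" .
  \<comment> \<open>Zero energy gives \<open>Z x = Z y = 0\<close>. The Laplacian of
    \<open>V x + i V y\<close> times the nonzero eigenvalue then vanishes on \<open>C\<close>, so
    \<open>x\<close> and \<open>y\<close> vanish.\<close>
  have "energy x + energy y \<noteq> 0"
  proof
    assume "energy x + energy y = 0"
    then have "Z x = (\<lambda>\<xi>. 0)" "Z y = (\<lambda>\<xi>. 0)"
      using energy_zero[OF x] energy_zero[OF y] energy_nonneg[of x] energy_nonneg[of y] by auto
    then have "lap (Z x) \<xi> = 0" "lap (Z y) \<xi> = 0" for \<xi> by (simp_all add: lap_def)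
    then have eq: "b * lap (V y) \<xi> - a * lap (V x) \<xi> = 0"
        "- b * lap (V x) \<xi> - a * lap (V y) \<xi> = 0" if "\<xi> \<in> C" for \<xi>
      using Zx[OF that] Zy[OF that] by simp_all
    have "a * lap (V x) \<xi> - b * lap (V y) \<xi> = 0" "a * lap (V y) \<xi> + b * lap (V x) \<xi> = 0"
      if "\<xi> \<in> C" for \<xi>
      using eq[OF that] by linarith+
    then have "lap (V x) \<xi> = 0" "lap (V y) \<xi> = 0" if "\<xi> \<in> C" for \<xi>
      using rotation_scaling_kernel[OF _ _ ab] that by blast+
    then have "x = (\<lambda>\<xi>. 0)" "y = (\<lambda>\<xi>. 0)" using V_zero x y by blast+
    with nz show False by simp
  qed
  then have "k2 * ((a\<^sup>2 + b\<^sup>2 - a) * S) > 0"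
    using E energy_nonneg[of x] energy_nonneg[of y] by linarith
  then have "(a\<^sup>2 + b\<^sup>2 - a) * S < 0" using k2 by (simp add: zero_less_mult_iff)
  moreover have "S \<ge> 0" by (simp add: S_def)
  ultimately show ?thesis by (simp add: mult_less_0_iff)
qed

text \<open>The operator is block triangular with zero first column, so a nonzero eigenvalue belongs
  to the second diagonal block, with the continuum part of the eigenvector.\<close>

lemma T_eigen:
  assumes x: "x \<in> fun_on {-N..N}" and y: "y \<in> fun_on {-N..N}"
    and Tx: "sinclair_T k1 k2 A C x = (\<lambda>\<xi>. a * x \<xi> - b * y \<xi>)"
    and Ty: "sinclair_T k1 k2 A C y = (\<lambda>\<xi>. a * y \<xi> + b * x \<xi>)"
    and nz: "\<not> (x = (\<lambda>\<xi>. 0) \<and> y = (\<lambda>\<xi>. 0))" and ab: "a\<^sup>2 + b\<^sup>2 \<noteq> 0"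
  shows "a\<^sup>2 + b\<^sup>2 < a"
proof (rule cc_eigen[OF restr_in_fun_on restr_in_fun_on _ _ _ ab])
  have ac: "sinclair_ac k1 k2 A C (restr C u) \<xi> = 0" if "\<xi> \<in> C" for u \<xi>
    using lin_on_range[OF lin_ac restr_in_fun_on, of u] that AC(1) by (auto simp: fun_on_def)
  have cc: "sinclair_cc k1 k2 A C (restr C u) \<xi> = (if \<xi> \<in> C then sinclair_T k1 k2 A C u \<xi> else 0)" for u \<xi>
    using lin_on_range[OF lin_cc restr_in_fun_on, of u] ac[of \<xi> u]
    by (auto simp: fun_on_def sinclair_T_def)
  show "sinclair_cc k1 k2 A C (restr C x) = (\<lambda>\<xi>. a * restr C x \<xi> + (- b) * restr C y \<xi>)"
    by (auto simp: fun_eq_iff cc Tx restr_apply)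
  show "sinclair_cc k1 k2 A C (restr C y) = (\<lambda>\<xi>. a * restr C y \<xi> + b * restr C x \<xi>)"
    by (auto simp: fun_eq_iff cc Ty restr_apply)
  show "\<not> (restr C x = (\<lambda>\<xi>. 0) \<and> restr C y = (\<lambda>\<xi>. 0))"
  proof
    assume "restr C x = (\<lambda>\<xi>. 0) \<and> restr C y = (\<lambda>\<xi>. 0)"
    \<comment> \<open>An eigenvector without continuum part is mapped to zero, which contradicts a
      nonzero eigenvalue.\<close>
    then have "sinclair_T k1 k2 A C x = (\<lambda>\<xi>. 0)" "sinclair_T k1 k2 A C y = (\<lambda>\<xi>. 0)"
      by (simp_all add: sinclair_T_def lin_on_zero[OF lin_ac] lin_on_zero[OF lin_cc])
    with Tx Ty have eq: "a * x \<xi> - b * y \<xi> = 0" "a * y \<xi> + b * x \<xi> = 0" for \<xi>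
      by (simp_all add: fun_eq_iff)
    have "x \<xi> = 0" "y \<xi> = 0" for \<xi>
      using rotation_scaling_kernel[OF eq ab] by auto
    with nz show False by auto
  qed
qed

end

section \<open>Passing between the operator and its matrix\<close>

lemma op_mat_apply:
  assumes T: "lin_on {-N..N} {-N..N} T" and u: "u \<in> fun_on {-N..N}"
    and i: "i < nat (2 * N + 1)"
  shows "(\<Sum>j<nat (2 * N + 1). op_mat N T $$ (i, j) * u (int j - N)) = T u (int i - N)"
proof -
  have "T u = T (\<lambda>\<xi>. \<Sum>j\<in>{-N..N}. u j * unit_fun j \<xi>)"
    by (rule arg_cong[OF fun_on_expand[OF _ u]]) simp
  also have "\<dots> = (\<lambda>\<xi>. \<Sum>j\<in>{-N..N}. u j * T (unit_fun j) \<xi>)"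
    by (rule lin_on_sum[OF T]) (simp_all add: unit_fun_in_fun_on)
  finally have "T u (int i - N) = (\<Sum>j\<in>{-N..N}. u j * T (unit_fun j) (int i - N))"
    by simp
  also have "\<dots> = (\<Sum>j<nat (2 * N + 1). u (int j - N) * T (unit_fun (int j - N)) (int i - N))"
    by (rule sum.reindex_bij_witness[of _ "\<lambda>j. int j - N" "\<lambda>\<xi>. nat (\<xi> + N)"]) auto
  finally show ?thesis
    using i by (auto simp: op_mat_def unit_fun_def mult.commute intro!: sum.cong)
qed

text \<open>Here \<open>x\<close> and \<open>y\<close> are the real and imaginary part of an eigenvector.\<close>

lemma op_mat_eigenvector:
  assumes T: "lin_on {-N..N} {-N..N} T"
    and ev: "eigenvalue (map_mat complex_of_real (op_mat N T)) z"
  obtains x y where "x \<in> fun_on {-N..N}" "y \<in> fun_on {-N..N}"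
    "T x = (\<lambda>\<xi>. Re z * x \<xi> - Im z * y \<xi>)" "T y = (\<lambda>\<xi>. Re z * y \<xi> + Im z * x \<xi>)"
    "\<not> (x = (\<lambda>\<xi>. 0) \<and> y = (\<lambda>\<xi>. 0))"
proof -
  let ?n = "nat (2 * N + 1)" and ?P = "op_mat N T"
  let ?B = "map_mat complex_of_real ?P"
  have dim: "dim_row ?B = ?n" "dim_col ?B = ?n" by (simp_all add: op_mat_def)
  from ev obtain v where v: "v \<in> carrier_vec ?n" "v \<noteq> 0\<^sub>v ?n" "?B *\<^sub>v v = z \<cdot>\<^sub>v v"
    unfolding eigenvalue_def eigenvector_def dim by auto
  \<comment> \<open>The complex eigenvector is moved to the sites by the shift \<open>N\<close> and
    extended by zero.\<close>
  define w where "w \<xi> = (if \<xi> \<in> {-N..N} then v $ nat (\<xi> + N) else 0)" for \<xi>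
  define x where "x = (\<lambda>\<xi>. Re (w \<xi>))"
  define y where "y = (\<lambda>\<xi>. Im (w \<xi>))"
  have x: "x \<in> fun_on {-N..N}" and y: "y \<in> fun_on {-N..N}"
    by (simp_all add: x_def y_def w_def fun_on_def)
  have w: "v $ j = w (int j - N)" if "j < ?n" for j
    using that by (auto simp: w_def)
  have row: "(\<Sum>j<?n. complex_of_real (?P $$ (i, j)) * w (int j - N)) = z * w (int i - N)"
    if i: "i < ?n" for i
  proof -
    have "z * w (int i - N) = (z \<cdot>\<^sub>v v) $ i" using i v(1) by (simp add: w)
    also have "\<dots> = (?B *\<^sub>v v) $ i" by (simp add: v(3))
    also have "\<dots> = (\<Sum>j<?n. complex_of_real (?P $$ (i, j)) * w (int j - N))"
      using i v(1) dim by (auto simp: scalar_prod_def w atLeast0LessThan intro!: sum.cong)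
    finally show ?thesis by simp
  qed
  have eq: "T x \<xi> = Re z * x \<xi> - Im z * y \<xi>" "T y \<xi> = Re z * y \<xi> + Im z * x \<xi>"
    if \<xi>: "\<xi> \<in> {-N..N}" for \<xi>
  proof -
    define i where "i = nat (\<xi> + N)"
    have i: "i < ?n" "int i - N = \<xi>" using \<xi> by (auto simp: i_def)
    \<comment> \<open>The matrix entries are real, so taking real parts of a row turns its left side
      into the same row applied to \<open>x\<close>; imaginary parts do the same for
      \<open>y\<close>.\<close>
    show "T x \<xi> = Re z * x \<xi> - Im z * y \<xi>"
      using arg_cong[OF row[OF i(1)], of Re] op_mat_apply[OF T x i(1)]
      by (simp add: i(2) x_def y_def)
    show "T y \<xi> = Re z * y \<xi> + Im z * x \<xi>"
      using arg_cong[OF row[OF i(1)], of Im] op_mat_apply[OF T y i(1)]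
      by (simp add: i(2) x_def y_def)
  qed
  show ?thesis
  proof (rule that[OF x y])
    show "T x = (\<lambda>\<xi>. Re z * x \<xi> - Im z * y \<xi>)"
    proof
      fix \<xi> show "T x \<xi> = Re z * x \<xi> - Im z * y \<xi>"
        using eq(1)[of \<xi>] lin_on_range[OF T x] x y by (cases "\<xi> \<in> {-N..N}") (auto simp: fun_on_def)
    qed
    show "T y = (\<lambda>\<xi>. Re z * y \<xi> + Im z * x \<xi>)"
    proof
      fix \<xi> show "T y \<xi> = Re z * y \<xi> + Im z * x \<xi>"
        using eq(2)[of \<xi>] lin_on_range[OF T y] x y by (cases "\<xi> \<in> {-N..N}") (auto simp: fun_on_def)
    qed
    show "\<not> (x = (\<lambda>\<xi>. 0) \<and> y = (\<lambda>\<xi>. 0))"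
    proof
      assume "x = (\<lambda>\<xi>. 0) \<and> y = (\<lambda>\<xi>. 0)"
      then have "w \<xi> = 0" for \<xi>
        by (auto simp: x_def y_def fun_eq_iff complex_eq_iff)
      then have "v = 0\<^sub>v ?n" using v(1) w by (intro eq_vecI) auto
      with v(2) show False by simp
    qed
  qed
qed

section \<open>The bound on the spectral radius\<close>

theorem theorem2:
  fixes M N :: int and k1 k2 :: real
  assumes "M \<ge> 1" and "N \<ge> M + 2"
    and "k1 > 0" and "k2 < 0" and "k1 + 4 * k2 > 0"
  shows "op_spectral_radius N (sinclair_T k1 k2 (Lam_a M) (Lam_c M N)) < 1"
proof -
  interpret sinclair M N k1 k2
    using assms by unfold_locales
  let ?n = "nat (2 * N + 1)"
  let ?B = "map_mat complex_of_real (op_mat N (sinclair_T k1 k2 A C))"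
  have B: "?B \<in> carrier_mat ?n ?n" by (simp add: op_mat_def)
  have "?n > 0" using assms by simp
  \<comment> \<open>A matrix of positive dimension has an eigenvalue whose modulus is the spectral
    radius, so bounding one eigenvalue suffices.\<close>
  from spectral_radius_mem_max(1)[OF B] this obtain z where
    z: "eigenvalue ?B z" "spectral_radius ?B = cmod z"
    by (auto simp: spectrum_def)
  obtain x y where xy: "x \<in> fun_on {-N..N}" "y \<in> fun_on {-N..N}"
    "sinclair_T k1 k2 A C x = (\<lambda>\<xi>. Re z * x \<xi> - Im z * y \<xi>)"
    "sinclair_T k1 k2 A C y = (\<lambda>\<xi>. Re z * y \<xi> + Im z * x \<xi>)"
    "\<not> (x = (\<lambda>\<xi>. 0) \<and> y = (\<lambda>\<xi>. 0))"
    by (rule op_mat_eigenvector[OF lin_T z(1)])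
  have "cmod z < 1"
  proof (cases "z = 0")
    case False
    then have "(Re z)\<^sup>2 + (Im z)\<^sup>2 \<noteq> 0" by (metis cmod_power2 norm_eq_zero power_not_zero)
    \<comment> \<open>The estimate places \<open>z\<close> in the open disc of radius 1/2 about 1/2;
      comparing \<open>Re z\<close> with \<open>cmod z\<close> and cancelling one factor
      \<open>cmod z\<close> gives the bound.\<close>
    from T_eigen[OF xy this] have "(cmod z)\<^sup>2 < Re z" by (simp add: cmod_power2)
    also have "Re z \<le> cmod z" by (rule complex_Re_le_cmod)
    finally have "cmod z * cmod z < cmod z * 1" by (simp add: power2_eq_square)
    then show ?thesis using False by (simp add: mult_less_cancel_left)
  qed simp
  then show ?thesis by (simp add: op_spectral_radius_def z(2))
qed

end
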